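(* Let $\mathcal{C}$ and $\mathcal{D}$ be accessible categories with $\mathcal{D}$ cocomplete. If $t$ is an accessible monad on $\mathcal{C}$, $k$ is an accessible comonad on $\mathcal{C}$, $\alpha\colon t\circ k\to k\circ t$ is a distributive law (of the monad $t$ over the comonad $k$), and $p\colon\mathcal{C}\to\mathcal{D}$ is any accessible functor, then the left Kan extension $\mathrm{Lan}_{p\circ t}(p\circ k)\colon\mathcal{D}\to\mathcal{D}$ of $p\circ k$ along $p\circ t$ has the structure of a comonad on $\mathcal{D}$.
   Context: An accessible (co)monad is one whose underlying endofunctor is accessible. For accessible functors $q\colon\mathcal{C}\to\mathcal{C}'$ and $r\colon\mathcal{C}\to\mathcal{D}$ between accessible categories with $\mathcal{D}$ cocomplete, $\mathrm{Lan}_q(r)\colon\mathcal{C}'\to\mathcal{D}$ denotes the left Kan extension of $r$ along $q$ (it exists): it comes with a natural transformation $r\Rightarrow\mathrm{Lan}_q(r)\circ q$ inducing, for every $s\colon\mathcal{C}'\to\mathcal{D}$, a bijection between natural transformations $\mathrm{Lan}_q(r)\Rightarrow s$ and natural transformations $r\Rightarrow s\circ q$. Write $(t,\eta,\mu)$ for the monad, $(k,\epsilon,\delta)$ for the comonad, and omit $\circ$. A distributive law of $t$ over $k$ is a natural transformation $\alpha\colon tk\Rightarrow kt$ satisfying the four laws: $\alpha\cdot(\eta k)=k\eta$; $\alpha\cdot(\mu k)=(k\mu)\cdot(\alpha t)\cdot(t\alpha)$; $(\epsilon t)\cdot\alpha=t\epsilon$; $(\delta t)\cdot\alpha=(k\alpha)\cdot(\alpha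 k)\cdot(t\delta)$. *)

theory Defs
  imports "HOL-Library.FuncSet"
begin

unbundle cardinal_syntax

record ('o, 'a) cat =
  Obj :: "'o set"
  Arr :: "'a set"
  Dom :: "'a \<Rightarrow> 'o"
  Cod :: "'a \<Rightarrow> 'o"
  Ide :: "'o \<Rightarrow> 'a"
  Comp :: "'a \<Rightarrow> 'a \<Rightarrow> 'a"  (infixr \<open>\<cdot>\<index>\<close> 70)

definition hom :: "('o, 'a) cat \<Rightarrow> 'o \<Rightarrow> 'o \<Rightarrow> 'a set" where
  "hom C x y = {f \<in> Arr C. Dom C f = x \<and> Cod C f = y}"

locale category =
  fixes C :: "('o, 'a) cat" (structure)
  assumes Dom_in: "f \<in> Arr C \<Longrightarrow> Dom C f \<in> Obj C"
    and Cod_in: "f \<in> Arr C \<Longrightarrow> Cod C f \<in> Obj C"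
    and Ide_in: "x \<in> Obj C \<Longrightarrow> Ide C x \<in> hom C x x"
    and Comp_in: "\<lbrakk>f \<in> hom C x y; g \<in> hom C y z\<rbrakk> \<Longrightarrow> g \<cdot> f \<in> hom C x z"
    and Comp_Ide_left: "f \<in> hom C x y \<Longrightarrow> Ide C y \<cdot> f = f"
    and Comp_Ide_right: "f \<in> hom C x y \<Longrightarrow> f \<cdot> Ide C x = f"
    and Comp_assoc:
      "\<lbrakk>f \<in> hom C w x; g \<in> hom C x y; h \<in> hom C y z\<rbrakk> \<Longrightarrow> (h \<cdot> g) \<cdot> f = h \<cdot> (g \<cdot> f)"

record ('o1, 'a1, 'o2, 'a2) ftor =
  omap :: "'o1 \<Rightarrow> 'o2"
  amap :: "'a1 \<Rightarrow> 'a2"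

locale is_functor = A: category A + B: category B
  for A :: "('o1, 'a1) cat" and B :: "('o2, 'a2) cat" +
  fixes F :: "('o1, 'a1, 'o2, 'a2) ftor"
  assumes omap_in: "x \<in> Obj A \<Longrightarrow> omap F x \<in> Obj B"
    and amap_in: "f \<in> hom A x y \<Longrightarrow> amap F f \<in> hom B (omap F x) (omap F y)"
    and amap_Ide: "x \<in> Obj A \<Longrightarrow> amap F (Ide A x) = Ide B (omap F x)"
    and amap_Comp: "\<lbrakk>f \<in> hom A x y; g \<in> hom A y z\<rbrakk> \<Longrightarrow>
      amap F (g \<cdot>\<^bsub>A\<^esub> f) = amap F g \<cdot>\<^bsub>B\<^esub> amap F f"

definition idF :: "('o, 'a, 'o, 'a) ftor" where
  "idF = \<lparr>omap = id, amap = id\<rparr>"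

definition compF :: "('o2, 'a2, 'o3, 'a3) ftor \<Rightarrow> ('o1, 'a1, 'o2, 'a2) ftor \<Rightarrow>
    ('o1, 'a1, 'o3, 'a3) ftor"  (infixr \<open>\<circ>F\<close> 75) where
  "G \<circ>F F = \<lparr>omap = omap G \<circ> omap F, amap = amap G \<circ> amap F\<rparr>"

text \<open>A natural transformation is given by its components. Only the components at objects of the
  source category are meaningful, so equations between natural transformations are always stated
  for all objects in the carrier.\<close>

locale nat_trans = F: is_functor A B F + G: is_functor A B G
  for A :: "('o1, 'a1) cat" and B :: "('o2, 'a2) cat"
    and F G :: "('o1, 'a1, 'o2, 'a2) ftor" +
  fixes \<tau> :: "'o1 \<Rightarrow> 'a2"
  assumes component_in: "x \<in> Obj A \<Longrightarrow> \<tau> x \<in> hom B (omap F x) (omap G x)"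
    and naturality: "f \<in> hom A x y \<Longrightarrow> \<tau> y \<cdot>\<^bsub>B\<^esub> amap F f = amap G f \<cdot>\<^bsub>B\<^esub> \<tau> x"

locale monad = T: is_functor C C t + eta: nat_trans C C idF t \<eta> + mu: nat_trans C C "t \<circ>F t" t \<mu>
  for C :: "('o, 'a) cat" (structure) and t \<eta> \<mu> +
  assumes mu_assoc: "x \<in> Obj C \<Longrightarrow> \<mu> x \<cdot> amap t (\<mu> x) = \<mu> x \<cdot> \<mu> (omap t x)"
    and mu_eta_left: "x \<in> Obj C \<Longrightarrow> \<mu> x \<cdot> \<eta> (omap t x) = Ide C (omap t x)"
    and mu_eta_right: "x \<in> Obj C \<Longrightarrow> \<mu> x \<cdot> amap t (\<eta> x) = Ide C (omap t x)"

locale comonad = K: is_functor C C k + eps: nat_trans C C k idF \<epsilon> + delta: nat_trans C C k "k \<circ>F k" \<delta>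
  for C :: "('o, 'a) cat" (structure) and k \<epsilon> \<delta> +
  assumes delta_coassoc: "x \<in> Obj C \<Longrightarrow> amap k (\<delta> x) \<cdot> \<delta> x = \<delta> (omap k x) \<cdot> \<delta> x"
    and eps_delta_left: "x \<in> Obj C \<Longrightarrow> \<epsilon> (omap k x) \<cdot> \<delta> x = Ide C (omap k x)"
    and eps_delta_right: "x \<in> Obj C \<Longrightarrow> amap k (\<epsilon> x) \<cdot> \<delta> x = Ide C (omap k x)"

locale distributive_law =
  T: monad C t \<eta> \<mu> + K: comonad C k \<epsilon> \<delta> + alpha: nat_trans C C "t \<circ>F k" "k \<circ>F t" \<alpha>
  for C :: "('o, 'a) cat" (structure) and t \<eta> \<mu> k \<epsilon> \<delta> \<alpha> +
  assumes alpha_eta: "x \<in> Obj C \<Longrightarrow> \<alpha> x \<cdot> \<eta> (omap k x) = amap k (\<eta> x)"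
    and alpha_mu: "x \<in> Obj C \<Longrightarrow>
      \<alpha> x \<cdot> \<mu> (omap k x) = amap k (\<mu> x) \<cdot> \<alpha> (omap t x) \<cdot> amap t (\<alpha> x)"
    and eps_alpha: "x \<in> Obj C \<Longrightarrow> \<epsilon> (omap t x) \<cdot> \<alpha> x = amap t (\<epsilon> x)"
    and delta_alpha: "x \<in> Obj C \<Longrightarrow>
      \<delta> (omap t x) \<cdot> \<alpha> x = amap k (\<alpha> x) \<cdot> \<alpha> (omap k x) \<cdot> amap t (\<delta> x)"

text \<open>\<open>(L, u)\<close> is a left Kan extension of \<open>r : A \<rightarrow> E\<close> along \<open>q : A \<rightarrow> B\<close>: pasting with
  \<open>u : r \<Rightarrow> L \<circ> q\<close> is a bijection from transformations \<open>L \<Rightarrow> s\<close> to transformations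
  \<open>r \<Rightarrow> s \<circ> q\<close>, for every \<open>s : B \<rightarrow> E\<close>.\<close>

definition left_kan_extension ::
  "('o1, 'a1) cat \<Rightarrow> ('o2, 'a2) cat \<Rightarrow> ('o3, 'a3) cat \<Rightarrow>
   ('o1, 'a1, 'o2, 'a2) ftor \<Rightarrow> ('o1, 'a1, 'o3, 'a3) ftor \<Rightarrow>
   ('o2, 'a2, 'o3, 'a3) ftor \<Rightarrow> ('o1 \<Rightarrow> 'a3) \<Rightarrow> bool" where
  "left_kan_extension A B E q r L u \<longleftrightarrow>
     is_functor A B q \<and> is_functor A E r \<and> is_functor B E L \<and> nat_trans A E r (L \<circ>F q) u \<and>
     (\<forall>s \<beta>. is_functor B E s \<and> nat_trans A E r (s \<circ>F q) \<beta> \<longrightarrow>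
        (\<exists>\<sigma>. nat_trans B E L s \<sigma> \<and> (\<forall>a\<in>Obj A. \<sigma> (omap q a) \<cdot>\<^bsub>E\<^esub> u a = \<beta> a) \<and>
           (\<forall>\<sigma>'. nat_trans B E L s \<sigma>' \<and> (\<forall>a\<in>Obj A. \<sigma>' (omap q a) \<cdot>\<^bsub>E\<^esub> u a = \<beta> a) \<longrightarrow>
              (\<forall>b\<in>Obj B. \<sigma>' b = \<sigma> b))))"

text \<open>Smallness is relative to a Grothendieck universe, represented by its cardinal \<open>\<kappa>\<close>
  (an uncountable strongly inaccessible one): a set of any type is small if its cardinality is
  below \<open>\<kappa>\<close>. Since \<open>\<kappa>\<close> lives on the type \<open>'u\<close>, every small category is isomorphic to one whose
  objects and arrows are elements of \<open>'u\<close>, and every cardinal below \<open>\<kappa>\<close> is represented on \<open>'u\<close>;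
  hence small index categories and index cardinals are quantified over this type only.\<close>

definition inaccessible :: "'u rel \<Rightarrow> bool" where
  "inaccessible \<kappa> \<longleftrightarrow> Card_order \<kappa> \<and> natLeq <o \<kappa> \<and> regularCard \<kappa> \<and>
     (\<forall>X :: 'u set. |X| <o \<kappa> \<longrightarrow> |Pow X| <o \<kappa>)"

definition small_regular :: "'u rel \<Rightarrow> 'u rel \<Rightarrow> bool" where
  "small_regular \<kappa> l \<longleftrightarrow> Card_order l \<and> infinite (Field l) \<and> regularCard l \<and> l <o \<kappa>"

definition cat_below :: "'u rel \<Rightarrow> ('o, 'a) cat \<Rightarrow> bool" where
  "cat_below \<kappa> J \<longleftrightarrow> category J \<and> |Obj J| <o \<kappa> \<and> |Arr J| <o \<kappa>"

definition locally_small :: "'u rel \<Rightarrow> ('o, 'a) cat \<Rightarrow> bool" where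
  "locally_small \<kappa> C \<longleftrightarrow> category C \<and> (\<forall>x\<in>Obj C. \<forall>y\<in>Obj C. |hom C x y| <o \<kappa>)"

definition cocone ::
  "('oj, 'aj) cat \<Rightarrow> ('o, 'a) cat \<Rightarrow> ('oj, 'aj, 'o, 'a) ftor \<Rightarrow> 'o \<Rightarrow> ('oj \<Rightarrow> 'a) \<Rightarrow> bool" where
  "cocone J C F c \<iota> \<longleftrightarrow> c \<in> Obj C \<and> (\<forall>j\<in>Obj J. \<iota> j \<in> hom C (omap F j) c) \<and>
     (\<forall>i j f. f \<in> hom J i j \<longrightarrow> \<iota> j \<cdot>\<^bsub>C\<^esub> amap F f = \<iota> i)"

definition is_colimit ::
  "('oj, 'aj) cat \<Rightarrow> ('o, 'a) cat \<Rightarrow> ('oj, 'aj, 'o, 'a) ftor \<Rightarrow> 'o \<Rightarrow> ('oj \<Rightarrow> 'a) \<Rightarrow> bool" where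
  "is_colimit J C F c \<iota> \<longleftrightarrow> cocone J C F c \<iota> \<and>
     (\<forall>d \<theta>. cocone J C F d \<theta> \<longrightarrow>
        (\<exists>!h. h \<in> hom C c d \<and> (\<forall>j\<in>Obj J. h \<cdot>\<^bsub>C\<^esub> \<iota> j = \<theta> j)))"

definition cocomplete :: "'u rel \<Rightarrow> ('o, 'a) cat \<Rightarrow> bool" where
  "cocomplete \<kappa> C \<longleftrightarrow> category C \<and>
     (\<forall>(J :: ('u, 'u) cat) F. cat_below \<kappa> J \<and> is_functor J C F \<longrightarrow> (\<exists>c \<iota>. is_colimit J C F c \<iota>))"

text \<open>\<open>J\<close> is \<open>l\<close>-filtered if every diagram in \<open>J\<close> of size less than \<open>l\<close> has a cocone.\<close>

definition filtered :: "'u rel \<Rightarrow> ('o, 'a) cat \<Rightarrow> bool" where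
  "filtered l J \<longleftrightarrow> category J \<and>
     (\<forall>(I :: ('u, 'u) cat) G. cat_below l I \<and> is_functor I J G \<longrightarrow> (\<exists>j \<iota>. cocone I J G j \<iota>))"

definition has_filtered_colimits :: "'u rel \<Rightarrow> 'u rel \<Rightarrow> ('o, 'a) cat \<Rightarrow> bool" where
  "has_filtered_colimits \<kappa> l C \<longleftrightarrow>
     (\<forall>(J :: ('u, 'u) cat) F. cat_below \<kappa> J \<and> filtered l J \<and> is_functor J C F \<longrightarrow>
        (\<exists>c \<iota>. is_colimit J C F c \<iota>))"

definition preserves_filtered_colimits :: "'u rel \<Rightarrow> 'u rel \<Rightarrow>
    ('o1, 'a1) cat \<Rightarrow> ('o2, 'a2) cat \<Rightarrow> ('o1, 'a1, 'o2, 'a2) ftor \<Rightarrow> bool" where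
  "preserves_filtered_colimits \<kappa> l A B H \<longleftrightarrow>
     (\<forall>(J :: ('u, 'u) cat) F c \<iota>.
        cat_below \<kappa> J \<and> filtered l J \<and> is_functor J A F \<and> is_colimit J A F c \<iota> \<longrightarrow>
        is_colimit J B (H \<circ>F F) (omap H c) (\<lambda>j. amap H (\<iota> j)))"

text \<open>The category of small subsets of the type \<open>'v\<close>; a map is recorded with its domain and
  codomain.\<close>

definition set_cat :: "'u rel \<Rightarrow> ('v set, 'v set \<times> ('v \<Rightarrow> 'v) \<times> 'v set) cat" where
  "set_cat \<kappa> = \<lparr>
     Obj = {X. |X| <o \<kappa>},
     Arr = {(X, f, Y). |X| <o \<kappa> \<and> |Y| <o \<kappa> \<and> f \<in> X \<rightarrow>\<^sub>E Y},
     Dom = (\<lambda>(X, f, Y). X),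
     Cod = (\<lambda>(X, f, Y). Y),
     Ide = (\<lambda>X. (X, restrict id X, X)),
     Comp = (\<lambda>(Y', g, Z) (X, f, Y). (X, compose X g f, Z))\<rparr>"

text \<open>The functor \<open>C(c, -)\<close>. Its values are coded inside \<open>'a + 'u\<close>, because that type contains
  both the hom-sets of \<open>C\<close> and a copy of every small set, whatever the size of \<open>'a\<close>.\<close>

definition hom_ftor :: "('o, 'a) cat \<Rightarrow> 'o \<Rightarrow>
    ('o, 'a, ('a + 'u) set, ('a + 'u) set \<times> ('a + 'u \<Rightarrow> 'a + 'u) \<times> ('a + 'u) set) ftor" where
  "hom_ftor C c = \<lparr>
     omap = (\<lambda>x. Inl ` hom C c x),
     amap = (\<lambda>f. (Inl ` hom C c (Dom C f),
                  restrict (\<lambda>g. Inl (f \<cdot>\<^bsub>C\<^esub> projl g)) (Inl ` hom C c (Dom C f)),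
                  Inl ` hom C c (Cod C f)))\<rparr>"

definition presentable :: "'u rel \<Rightarrow> 'u rel \<Rightarrow> ('o, 'a) cat \<Rightarrow> 'o \<Rightarrow> bool" where
  "presentable \<kappa> l C c \<longleftrightarrow> c \<in> Obj C \<and>
     preserves_filtered_colimits \<kappa> l C (set_cat \<kappa>)
       (hom_ftor C c :: ('o, 'a, ('a + 'u) set, _) ftor)"

definition accessible_at :: "'u rel \<Rightarrow> 'u rel \<Rightarrow> ('o, 'a) cat \<Rightarrow> bool" where
  "accessible_at \<kappa> l C \<longleftrightarrow> small_regular \<kappa> l \<and> locally_small \<kappa> C \<and> has_filtered_colimits \<kappa> l C \<and>
     (\<exists>P \<subseteq> Obj C. |P| <o \<kappa> \<and> (\<forall>p\<in>P. presentable \<kappa> l C p) \<and>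
        (\<forall>c\<in>Obj C. \<exists>(J :: ('u, 'u) cat) F \<iota>.
           cat_below \<kappa> J \<and> filtered l J \<and> is_functor J C F \<and> omap F ` Obj J \<subseteq> P \<and>
           is_colimit J C F c \<iota>))"

definition accessible_category :: "'u rel \<Rightarrow> ('o, 'a) cat \<Rightarrow> bool" where
  "accessible_category \<kappa> C \<longleftrightarrow> (\<exists>l. accessible_at \<kappa> l C)"

definition accessible_functor :: "'u rel \<Rightarrow>
    ('o1, 'a1) cat \<Rightarrow> ('o2, 'a2) cat \<Rightarrow> ('o1, 'a1, 'o2, 'a2) ftor \<Rightarrow> bool" where
  "accessible_functor \<kappa> A B F \<longleftrightarrow> is_functor A B F \<and>
     (\<exists>l. accessible_at \<kappa> l A \<and> accessible_at \<kappa> l B \<and> preserves_filtered_colimits \<kappa> l A B F)"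

definition accessible_monad where
  "accessible_monad \<kappa> C t \<eta> \<mu> \<longleftrightarrow> monad C t \<eta> \<mu> \<and> accessible_functor \<kappa> C C t"

definition accessible_comonad where
  "accessible_comonad \<kappa> C k \<epsilon> \<delta> \<longleftrightarrow> comonad C k \<epsilon> \<delta> \<and> accessible_functor \<kappa> C C k"

end

theory Submission
  imports Defs
begin

text \<open>By the universal property of \<open>u : p k \<Rightarrow> L p t\<close>, a transformation out of \<open>L\<close> is determined by
  its restriction along \<open>u\<close>. The counit \<open>L \<Rightarrow> 1\<close> corresponds to
  \<open>p (\<eta> \<epsilon>) : p k \<Rightarrow> p t\<close>, and the comultiplication \<open>L \<Rightarrow> L L\<close> to the composite
  \<open>p k \<rightarrow> p k k \<rightarrow> L p t k \<rightarrow> L p k t \<rightarrow> L L p t t \<rightarrow> L L p t\<close> of \<open>\<delta>\<close>, \<open>u\<close>, \<open>\<alpha>\<close>, \<open>u\<close> and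
  \<open>\<mu>\<close>. After restriction along \<open>u\<close>, each comonad law reduces to a monad law of \<open>t\<close>, the
  matching comonad law of \<open>k\<close> and the compatibilities of \<open>\<alpha>\<close>.\<close>

section \<open>Typing and composition rules for simplification\<close>

lemma omap_idF [simp]: "omap idF x = x"
  and amap_idF [simp]: "amap idF f = f"
  by (simp_all add: idF_def)

lemma omap_compF [simp]: "omap (G \<circ>F F) x = omap G (omap F x)"
  and amap_compF [simp]: "amap (G \<circ>F F) f = amap G (amap F f)"
  by (simp_all add: compF_def)

context category
begin

text \<open>The locale rules mention intermediate objects through \<open>hom\<close>, which a
  rewriter would have to guess. In terms of \<open>Arr\<close>, \<open>Dom\<close> and
  \<open>Cod\<close> every side condition of a composite reduces to an equation that simplification
  can check.\<close>

lemma Comp_typing: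
  assumes "f \<in> Arr C" "g \<in> Arr C" "Cod C f = Dom C g"
  shows "g \<cdot> f \<in> Arr C" "Dom C (g \<cdot> f) = Dom C f" "Cod C (g \<cdot> f) = Cod C g"
  using Comp_in[of f "Dom C f" "Dom C g" g "Cod C g"] assms by (auto simp: hom_def)

lemma Ide_typing:
  assumes "x \<in> Obj C"
  shows "Ide C x \<in> Arr C" "Dom C (Ide C x) = x" "Cod C (Ide C x) = x"
  using Ide_in[OF assms] by (auto simp: hom_def)

lemma Comp_Ide_left_Arr: "\<lbrakk>f \<in> Arr C; Cod C f = x\<rbrakk> \<Longrightarrow> Ide C x \<cdot> f = f"
  using Comp_Ide_left[of f "Dom C f"] by (auto simp: hom_def)

lemma Comp_Ide_right_Arr: "\<lbrakk>f \<in> Arr C; Dom C f = x\<rbrakk> \<Longrightarrow> f \<cdot> Ide C x = f"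
  using Comp_Ide_right[of f _ "Cod C f"] by (auto simp: hom_def)

lemma Comp_assoc_Arr:
  "\<lbrakk>f \<in> Arr C; g \<in> Arr C; h \<in> Arr C; Cod C f = Dom C g; Cod C g = Dom C h\<rbrakk>
    \<Longrightarrow> (h \<cdot> g) \<cdot> f = h \<cdot> (g \<cdot> f)"
  using Comp_assoc[of f "Dom C f" "Cod C f" g "Cod C g" h "Cod C h"] by (auto simp: hom_def)

end

context is_functor
begin

lemma amap_typing:
  assumes "f \<in> Arr A"
  shows "amap F f \<in> Arr B" "Dom B (amap F f) = omap F (Dom A f)"
    "Cod B (amap F f) = omap F (Cod A f)"
  using amap_in[of f "Dom A f" "Cod A f"] assms by (auto simp: hom_def)

lemma amap_Comp_Arr:
  "\<lbrakk>f \<in> Arr A; g \<in> Arr A; Cod A f = Dom A g\<rbrakk>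
    \<Longrightarrow> amap F (g \<cdot>\<^bsub>A\<^esub> f) = amap F g \<cdot>\<^bsub>B\<^esub> amap F f"
  using amap_Comp[of f "Dom A f" "Cod A f" g "Cod A g"] by (auto simp: hom_def)

end

context nat_trans
begin

lemma component_typing:
  assumes "x \<in> Obj A"
  shows "\<tau> x \<in> Arr B" "Dom B (\<tau> x) = omap F x" "Cod B (\<tau> x) = omap G x"
  using component_in[OF assms] by (auto simp: hom_def)

lemma naturality_Arr:
  "f \<in> Arr A \<Longrightarrow> \<tau> (Cod A f) \<cdot>\<^bsub>B\<^esub> amap F f = amap G f \<cdot>\<^bsub>B\<^esub> \<tau> (Dom A f)"
  using naturality[of f] by (auto simp: hom_def)

end

section \<open>Identities, composites and whiskering\<close>

lemma is_functor_idF: "category A \<Longrightarrow> is_functor A A idF"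
  by (simp add: is_functor_def is_functor_axioms_def)

lemma is_functor_compF:
  assumes "is_functor A B F" "is_functor B E G"
  shows "is_functor A E (G \<circ>F F)"
proof -
  interpret F: is_functor A B F by fact
  interpret G: is_functor B E G by fact
  show ?thesis
    by unfold_locales
      (auto simp: F.omap_in G.omap_in F.amap_in G.amap_in F.amap_Ide G.amap_Ide
        F.amap_Comp G.amap_Comp[OF F.amap_in F.amap_in])
qed

text \<open>The naturality premise supplies that both ends of \<open>f\<close> are objects, so that
  the typing of components applies to them at once.\<close>

lemma nat_transI:
  assumes "is_functor A B F" "is_functor A B G"
    and types: "\<And>x. x \<in> Obj A \<Longrightarrow>
      \<tau> x \<in> Arr B \<and> Dom B (\<tau> x) = omap F x \<and> Cod B (\<tau> x) = omap G x"
    and nat: "\<And>f. \<lbrakk>f \<in> Arr A; Dom A f \<in> Obj A; Cod A f \<in> Obj A\<rbrakk>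
      \<Longrightarrow> \<tau> (Cod A f) \<cdot>\<^bsub>B\<^esub> amap F f = amap G f \<cdot>\<^bsub>B\<^esub> \<tau> (Dom A f)"
  shows "nat_trans A B F G \<tau>"
proof -
  interpret F: is_functor A B F by fact
  interpret G: is_functor A B G by fact
  show ?thesis
    by unfold_locales
      (use types nat in \<open>auto simp: hom_def F.A.Dom_in F.A.Cod_in\<close>)
qed

lemma nat_trans_Ide:
  assumes "is_functor A B F"
  shows "nat_trans A B F F (\<lambda>x. Ide B (omap F x))"
proof -
  interpret F: is_functor A B F by fact
  show ?thesis
    by (rule nat_transI[OF assms assms])
      (simp_all add: F.omap_in F.B.Ide_typing F.amap_typing F.B.Comp_Ide_left_Arr
        F.B.Comp_Ide_right_Arr)
qed

lemma nat_trans_vcomp: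
  assumes "nat_trans A B F G \<sigma>" "nat_trans A B G H \<tau>"
  shows "nat_trans A B F H (\<lambda>x. \<tau> x \<cdot>\<^bsub>B\<^esub> \<sigma> x)"
proof -
  interpret S: nat_trans A B F G \<sigma> by fact
  interpret T: nat_trans A B G H \<tau> by fact
  note types = S.component_typing T.component_typing S.F.amap_typing S.G.amap_typing
    T.G.amap_typing S.F.B.Comp_typing
  show ?thesis
  proof (rule nat_transI[OF S.F.is_functor_axioms T.G.is_functor_axioms])
    fix f assume f [simp]: "f \<in> Arr A" "Dom A f \<in> Obj A" "Cod A f \<in> Obj A"
    have "(\<tau> (Cod A f) \<cdot>\<^bsub>B\<^esub> \<sigma> (Cod A f)) \<cdot>\<^bsub>B\<^esub> amap F f
        = \<tau> (Cod A f) \<cdot>\<^bsub>B\<^esub> (amap G f \<cdot>\<^bsub>B\<^esub> \<sigma> (Dom A f))"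
      by (simp add: types S.F.B.Comp_assoc_Arr S.naturality_Arr)
    also have "\<dots> = (\<tau> (Cod A f) \<cdot>\<^bsub>B\<^esub> amap G f) \<cdot>\<^bsub>B\<^esub> \<sigma> (Dom A f)"
      by (simp add: types S.F.B.Comp_assoc_Arr)
    also have "\<dots> = amap H f \<cdot>\<^bsub>B\<^esub> (\<tau> (Dom A f) \<cdot>\<^bsub>B\<^esub> \<sigma> (Dom A f))"
      by (simp add: types S.F.B.Comp_assoc_Arr T.naturality_Arr)
    finally show "(\<tau> (Cod A f) \<cdot>\<^bsub>B\<^esub> \<sigma> (Cod A f)) \<cdot>\<^bsub>B\<^esub> amap F f
        = amap H f \<cdot>\<^bsub>B\<^esub> (\<tau> (Dom A f) \<cdot>\<^bsub>B\<^esub> \<sigma> (Dom A f))" .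
  qed (simp add: types)
qed

lemma nat_trans_whisker_left:
  assumes "nat_trans A B F G \<tau>" "is_functor B E H"
  shows "nat_trans A E (H \<circ>F F) (H \<circ>F G) (\<lambda>x. amap H (\<tau> x))"
proof -
  interpret T: nat_trans A B F G \<tau> by fact
  interpret H: is_functor B E H by fact
  note types = T.component_typing T.F.amap_typing T.G.amap_typing H.amap_typing
  show ?thesis
    by (rule nat_transI[OF is_functor_compF[OF T.F.is_functor_axioms assms(2)]
          is_functor_compF[OF T.G.is_functor_axioms assms(2)]])
      (simp_all add: types T.naturality_Arr flip: H.amap_Comp_Arr)
qed

lemma nat_trans_whisker_right:
  assumes "nat_trans B E F G \<tau>" "is_functor A B H"
  shows "nat_trans A E (F \<circ>F H) (G \<circ>F H) (\<lambda>x. \<tau> (omap H x))"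
proof -
  interpret T: nat_trans B E F G \<tau> by fact
  interpret H: is_functor A B H by fact
  show ?thesis
    by (rule nat_transI[OF is_functor_compF[OF assms(2) T.F.is_functor_axioms]
          is_functor_compF[OF assms(2) T.G.is_functor_axioms]])
      (use T.naturality_Arr[OF H.amap_typing(1)] in
        \<open>simp_all add: H.omap_in T.component_typing H.amap_typing\<close>)
qed

text \<open>A literal equality of records: whiskered transformations can be rebracketed without
  inserting associators.\<close>

lemma compF_assoc: "(H \<circ>F G) \<circ>F F = H \<circ>F (G \<circ>F F)"
  by (simp add: compF_def comp_assoc)

lemma compF_idF [simp]: "idF \<circ>F F = F" "F \<circ>F idF = F"
  by (simp_all add: compF_def idF_def)

section \<open>Uniqueness and existence of factorizations through a left Kan extension\<close>

lemma left_kan_extension_unique: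
  assumes lan: "left_kan_extension A B E q r L u"
    and \<sigma>: "nat_trans B E L s \<sigma>" and \<sigma>': "nat_trans B E L s \<sigma>'"
    and eq: "\<And>a. a \<in> Obj A \<Longrightarrow> \<sigma> (omap q a) \<cdot>\<^bsub>E\<^esub> u a = \<sigma>' (omap q a) \<cdot>\<^bsub>E\<^esub> u a"
    and b: "b \<in> Obj B"
  shows "\<sigma> b = \<sigma>' b"
proof -
  have u: "nat_trans A E r (L \<circ>F q) u" and q: "is_functor A B q"
    using lan by (auto simp: left_kan_extension_def)
  have s: "is_functor B E s"
    using \<sigma> by (simp add: nat_trans_def)
  \<comment> \<open>The restriction of \<sigma> along \<open>u\<close> serves as the \<beta> of the
    universal property. The definition compares factorizations only with a chosen one, here \<rho>,
    so \<sigma> and \<sigma>' are both compared with \<rho>.\<close>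
  have "nat_trans A E r (s \<circ>F q) (\<lambda>a. \<sigma> (omap q a) \<cdot>\<^bsub>E\<^esub> u a)"
    by (rule nat_trans_vcomp[OF u nat_trans_whisker_right[OF \<sigma> q]])
  then obtain \<rho> where
    "\<forall>\<sigma>'. nat_trans B E L s \<sigma>' \<and>
      (\<forall>a\<in>Obj A. \<sigma>' (omap q a) \<cdot>\<^bsub>E\<^esub> u a = \<sigma> (omap q a) \<cdot>\<^bsub>E\<^esub> u a) \<longrightarrow>
      (\<forall>b\<in>Obj B. \<sigma>' b = \<rho> b)"
    using lan s unfolding left_kan_extension_def by blast
  then have \<rho>: "\<sigma>' b = \<rho> b" if "nat_trans B E L s \<sigma>'"
    "\<forall>a\<in>Obj A. \<sigma>' (omap q a) \<cdot>\<^bsub>E\<^esub> u a = \<sigma> (omap q a) \<cdot>\<^bsub>E\<^esub> u a" for \<sigma>'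
    using that b by blast
  show ?thesis
    using \<rho>[OF \<sigma>] \<rho>[OF \<sigma>'] eq by simp
qed

lemma left_kan_extension_factor:
  assumes "left_kan_extension A B E q r L u" "nat_trans A E r (s \<circ>F q) \<beta>" "is_functor B E s"
  obtains \<sigma> where "nat_trans B E L s \<sigma>" "\<And>a. a \<in> Obj A \<Longrightarrow> \<sigma> (omap q a) \<cdot>\<^bsub>E\<^esub> u a = \<beta> a"
proof -
  have "\<exists>\<sigma>. nat_trans B E L s \<sigma> \<and> (\<forall>a\<in>Obj A. \<sigma> (omap q a) \<cdot>\<^bsub>E\<^esub> u a = \<beta> a)"
    using assms unfolding left_kan_extension_def by blast
  then show thesis
    using that by blast
qed

section \<open>The transformations out of \<open>p k\<close> that induce the counit and the
  comultiplication\<close>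

locale distributive_law_kan = distributive_law C t \<eta> \<mu> k \<epsilon> \<delta> \<alpha> + P: is_functor C D p
  for C :: "('c, 'f) cat" and t \<eta> \<mu> k \<epsilon> \<delta> \<alpha>
    and D :: "('d, 'g) cat" (structure) and p +
  fixes L u
  assumes lan: "left_kan_extension C D D (p \<circ>F t) (p \<circ>F k) L u"

sublocale distributive_law_kan \<subseteq> L: is_functor D D L
  using lan by (simp add: left_kan_extension_def)

sublocale distributive_law_kan \<subseteq> u: nat_trans C D "p \<circ>F k" "L \<circ>F (p \<circ>F t)" u
  using lan by (simp add: left_kan_extension_def)

context distributive_law_kan
begin

lemmas typing =
  T.T.omap_in K.K.omap_in P.omap_in L.omap_in
  T.T.amap_typing K.K.amap_typing P.amap_typing L.amap_typing
  T.eta.component_typing T.mu.component_typing K.eps.component_typing K.delta.component_typing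
  alpha.component_typing u.component_typing
  T.T.A.Ide_typing P.B.Ide_typing T.T.A.Comp_typing P.B.Comp_typing

text \<open>The two images under \<open>p\<close> stay separate, since in the counit laws the \<eta>
  part merges with factors on its left or with \<alpha>, and the \<epsilon> part with factors on its
  right.\<close>

definition counit_datum :: "'c \<Rightarrow> 'g" where
  "counit_datum x = amap p (\<eta> x) \<cdot> amap p (\<epsilon> x)"

text \<open>Bracketed as \<open>amap L g \<cdot> h\<close> with \<open>g\<close> from
  \<open>p t k\<close> to \<open>L p t\<close> and \<open>h\<close> from \<open>p k\<close> to
  \<open>L p t k\<close>. The laws below treat \<open>g\<close> as a single arrow, along which
  \<epsilon>' and \<delta>' are natural.\<close>

definition comult_datum :: "'c \<Rightarrow> 'g" where
  "comult_datum x = amap L (amap L (amap p (\<mu> x)) \<cdot> u (omap t x) \<cdot> amap p (\<alpha> x))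
     \<cdot> u (omap k x) \<cdot> amap p (\<delta> x)"

text \<open>The target is written in the form \<open>s \<circ>F q\<close> with
  \<open>s = idF\<close>, ready for factorization through \<open>u\<close>.\<close>

lemma nat_trans_counit_datum: "nat_trans C D (p \<circ>F k) (idF \<circ>F (p \<circ>F t)) counit_datum"
proof -
  have "nat_trans C D (p \<circ>F k) (p \<circ>F t) (\<lambda>x. amap p (\<eta> x) \<cdot> amap p (\<epsilon> x))"
    using nat_trans_vcomp[OF
        nat_trans_whisker_left[OF K.eps.nat_trans_axioms P.is_functor_axioms]
        nat_trans_whisker_left[OF T.eta.nat_trans_axioms P.is_functor_axioms]] .
  then show ?thesis
    by (simp add: counit_datum_def[abs_def])
qed

lemma nat_trans_comult_datum: "nat_trans C D (p \<circ>F k) ((L \<circ>F L) \<circ>F (p \<circ>F t)) comult_datum"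
proof -
  \<comment> \<open>All five factors are typed with right-nested functor composites, so that
    consecutive sources and targets agree syntactically.\<close>
  have \<mu>: "nat_trans C D (L \<circ>F p \<circ>F t \<circ>F t) (L \<circ>F p \<circ>F t) (\<lambda>x. amap L (amap p (\<mu> x)))"
    using nat_trans_whisker_left[OF nat_trans_whisker_left[OF T.mu.nat_trans_axioms
        P.is_functor_axioms] L.is_functor_axioms] by (simp add: compF_assoc)
  have ut: "nat_trans C D (p \<circ>F k \<circ>F t) (L \<circ>F p \<circ>F t \<circ>F t) (\<lambda>x. u (omap t x))"
    using nat_trans_whisker_right[OF u.nat_trans_axioms T.T.is_functor_axioms]
    by (simp add: compF_assoc)
  have \<alpha>: "nat_trans C D (p \<circ>F t \<circ>F k) (p \<circ>F k \<circ>F t) (\<lambda>x. amap p (\<alpha> x))"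
    using nat_trans_whisker_left[OF alpha.nat_trans_axioms P.is_functor_axioms] .
  have uk: "nat_trans C D (p \<circ>F k \<circ>F k) (L \<circ>F p \<circ>F t \<circ>F k) (\<lambda>x. u (omap k x))"
    using nat_trans_whisker_right[OF u.nat_trans_axioms K.K.is_functor_axioms]
    by (simp add: compF_assoc)
  have \<delta>: "nat_trans C D (p \<circ>F k) (p \<circ>F k \<circ>F k) (\<lambda>x. amap p (\<delta> x))"
    using nat_trans_whisker_left[OF K.delta.nat_trans_axioms P.is_functor_axioms] .
  have "nat_trans C D (p \<circ>F k) (L \<circ>F L \<circ>F p \<circ>F t) comult_datum"
    unfolding comult_datum_def[abs_def]
    by (rule nat_trans_vcomp[OF nat_trans_vcomp[OF \<delta> uk]
          nat_trans_whisker_left[OF nat_trans_vcomp[OF nat_trans_vcomp[OF \<alpha> ut] \<mu>]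
            L.is_functor_axioms]])
  then show ?thesis
    by (simp add: compF_assoc)
qed

section \<open>The comonad laws after restriction along \<open>u\<close>\<close>

context
  fixes \<epsilon>' \<delta>' :: "'d \<Rightarrow> 'g"
  assumes counit: "nat_trans D D L idF \<epsilon>'"
    and counit_u: "\<And>x. x \<in> Obj C \<Longrightarrow> \<epsilon>' (omap p (omap t x)) \<cdot> u x = counit_datum x"
    and comult: "nat_trans D D L (L \<circ>F L) \<delta>'"
    and comult_u: "\<And>x. x \<in> Obj C \<Longrightarrow> \<delta>' (omap p (omap t x)) \<cdot> u x = comult_datum x"
begin

interpretation e: nat_trans D D L idF \<epsilon>' by (rule counit)
interpretation d: nat_trans D D L "L \<circ>F L" \<delta>' by (rule comult)

lemmas all_typing = typing e.component_typing d.component_typing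

text \<open>Naturality moves \<epsilon>' past \<open>amap L ?g\<close> until it meets
  \<open>u\<close> at \<open>k x\<close> and becomes \<open>counit_datum\<close>. There \<epsilon>
  cancels \<delta>, and \<open>alpha_eta\<close> turns \<alpha> after \<eta> into \<open>k\<close>
  of \<eta>; naturality of \<open>u\<close> changes this into \<open>L p t\<close> of \<eta>, which
  cancels \<mu>.\<close>

lemma counit_left_u:
  assumes x: "x \<in> Obj C"
  shows "(\<epsilon>' (omap L (omap p (omap t x))) \<cdot> \<delta>' (omap p (omap t x))) \<cdot> u x = u x"
proof -
  let ?g = "amap L (amap p (\<mu> x)) \<cdot> u (omap t x) \<cdot> amap p (\<alpha> x)"
  have "(\<epsilon>' (omap L (omap p (omap t x))) \<cdot> \<delta>' (omap p (omap t x))) \<cdot> u x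
      = \<epsilon>' (omap L (omap p (omap t x))) \<cdot> comult_datum x"
    using x by (simp add: all_typing P.B.Comp_assoc_Arr comult_u)
  also have "\<dots> = (\<epsilon>' (omap L (omap p (omap t x))) \<cdot> amap L ?g) \<cdot> u (omap k x) \<cdot> amap p (\<delta> x)"
    using x by (simp add: comult_datum_def all_typing P.B.Comp_assoc_Arr)
  also have "\<epsilon>' (omap L (omap p (omap t x))) \<cdot> amap L ?g = ?g \<cdot> \<epsilon>' (omap p (omap t (omap k x)))"
    using x e.naturality_Arr[of ?g] by (simp add: all_typing)
  also have "(?g \<cdot> \<epsilon>' (omap p (omap t (omap k x)))) \<cdot> u (omap k x) \<cdot> amap p (\<delta> x)
      = ?g \<cdot> (\<epsilon>' (omap p (omap t (omap k x))) \<cdot> u (omap k x)) \<cdot> amap p (\<delta> x)"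
    using x by (simp add: all_typing P.B.Comp_assoc_Arr)
  also have "\<dots> = ?g \<cdot> amap p (\<eta> (omap k x)) \<cdot> amap p (\<epsilon> (omap k x) \<cdot>\<^bsub>C\<^esub> \<delta> x)"
    using x by (simp add: all_typing P.B.Comp_assoc_Arr counit_u counit_datum_def P.amap_Comp_Arr)
  also have "\<dots> = amap L (amap p (\<mu> x)) \<cdot> u (omap t x) \<cdot> amap p (\<alpha> x \<cdot>\<^bsub>C\<^esub> \<eta> (omap k x))"
    using x by (simp add: all_typing P.B.Comp_assoc_Arr K.eps_delta_left P.amap_Ide
        P.B.Comp_Ide_right_Arr P.amap_Comp_Arr)
  also have "\<dots> = amap L (amap p (\<mu> x)) \<cdot> amap L (amap p (amap t (\<eta> x))) \<cdot> u x"
    using x u.naturality_Arr[of "\<eta> x"] by (simp add: all_typing alpha_eta)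
  also have "\<dots> = amap L (amap p (\<mu> x \<cdot>\<^bsub>C\<^esub> amap t (\<eta> x))) \<cdot> u x"
    using x by (simp add: all_typing P.B.Comp_assoc_Arr P.amap_Comp_Arr L.amap_Comp_Arr)
  also have "\<dots> = u x"
    using x by (simp add: all_typing T.mu_eta_right P.amap_Ide L.amap_Ide P.B.Comp_Ide_left_Arr)
  finally show ?thesis .
qed

text \<open>Here \<epsilon>' acts under \<open>L\<close>, directly on \<open>?g\<close>. Moved past
  \<mu>, it meets \<open>u\<close> at \<open>t x\<close>; then \<eta> cancels \<mu>, and
  \<open>eps_alpha\<close> leaves only \<open>p t\<close> of \<epsilon>. Naturality of
  \<open>u\<close> turns this into \<open>p k\<close> of \<epsilon>, which cancels \<delta>.\<close>

lemma counit_right_u: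
  assumes x: "x \<in> Obj C"
  shows "(amap L (\<epsilon>' (omap p (omap t x))) \<cdot> \<delta>' (omap p (omap t x))) \<cdot> u x = u x"
proof -
  let ?e = "\<epsilon>' (omap p (omap t x))" and ?h = "u (omap k x) \<cdot> amap p (\<delta> x)"
  let ?g = "amap L (amap p (\<mu> x)) \<cdot> u (omap t x) \<cdot> amap p (\<alpha> x)"
  have "(amap L ?e \<cdot> \<delta>' (omap p (omap t x))) \<cdot> u x = amap L ?e \<cdot> comult_datum x"
    using x by (simp add: all_typing P.B.Comp_assoc_Arr comult_u)
  also have "\<dots> = amap L (?e \<cdot> ?g) \<cdot> ?h"
    using x by (simp add: comult_datum_def all_typing P.B.Comp_assoc_Arr L.amap_Comp_Arr)
  also have "?e \<cdot> ?g = amap p (amap t (\<epsilon> x))"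
  proof -
    have "?e \<cdot> ?g = (?e \<cdot> amap L (amap p (\<mu> x))) \<cdot> u (omap t x) \<cdot> amap p (\<alpha> x)"
      using x by (simp add: all_typing P.B.Comp_assoc_Arr)
    also have "\<dots> = (amap p (\<mu> x) \<cdot> \<epsilon>' (omap p (omap t (omap t x)))) \<cdot> u (omap t x) \<cdot> amap p (\<alpha> x)"
      using x e.naturality_Arr[of "amap p (\<mu> x)"] by (simp add: all_typing)
    also have "\<dots> = amap p (\<mu> x) \<cdot> (\<epsilon>' (omap p (omap t (omap t x))) \<cdot> u (omap t x)) \<cdot> amap p (\<alpha> x)"
      using x by (simp add: all_typing P.B.Comp_assoc_Arr)
    also have "\<dots> = amap p (\<mu> x \<cdot>\<^bsub>C\<^esub> \<eta> (omap t x)) \<cdot> amap p (\<epsilon> (omap t x) \<cdot>\<^bsub>C\<^esub> \<alpha> x)"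
      using x by (simp add: all_typing P.B.Comp_assoc_Arr counit_u counit_datum_def P.amap_Comp_Arr)
    also have "\<dots> = amap p (amap t (\<epsilon> x))"
      using x by (simp add: all_typing T.mu_eta_left eps_alpha P.amap_Ide P.B.Comp_Ide_left_Arr)
    finally show ?thesis .
  qed
  also have "amap L (amap p (amap t (\<epsilon> x))) \<cdot> ?h
      = (amap L (amap p (amap t (\<epsilon> x))) \<cdot> u (omap k x)) \<cdot> amap p (\<delta> x)"
    using x by (simp add: all_typing P.B.Comp_assoc_Arr)
  also have "amap L (amap p (amap t (\<epsilon> x))) \<cdot> u (omap k x) = u x \<cdot> amap p (amap k (\<epsilon> x))"
    using x u.naturality_Arr[of "\<epsilon> x"] by (simp add: all_typing)
  also have "(u x \<cdot> amap p (amap k (\<epsilon> x))) \<cdot> amap p (\<delta> x)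
      = u x \<cdot> amap p (amap k (\<epsilon> x) \<cdot>\<^bsub>C\<^esub> \<delta> x)"
    using x by (simp add: all_typing P.B.Comp_assoc_Arr P.amap_Comp_Arr)
  also have "\<dots> = u x"
    using x by (simp add: all_typing K.eps_delta_right P.amap_Ide P.B.Comp_Ide_right_Arr)
  finally show ?thesis .
qed

text \<open>Both sides are brought to a common form with two copies of \<open>?g\<close>, at
  \<open>x\<close> and at \<open>k x\<close>, and one \<open>t\<close> of \<delta>. The left side
  uses the compatibility of \<alpha> with \<mu> and \<delta>, the right side the coassociativity of
  \<delta>.\<close>

lemma coassoc_u:
  assumes x: "x \<in> Obj C"
  shows "(amap L (\<delta>' (omap p (omap t x))) \<cdot> \<delta>' (omap p (omap t x))) \<cdot> u x
    = (\<delta>' (omap L (omap p (omap t x))) \<cdot> \<delta>' (omap p (omap t x))) \<cdot> u x"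
proof -
  let ?d = "\<delta>' (omap p (omap t x))"
  let ?g = "\<lambda>x. amap L (amap p (\<mu> x)) \<cdot> u (omap t x) \<cdot> amap p (\<alpha> x)"
  let ?h = "\<lambda>x. u (omap k x) \<cdot> amap p (\<delta> x)"
  let ?m = "amap L (amap p (\<mu> x)) \<cdot> amap L (amap p (\<mu> (omap t x)))
    \<cdot> u (omap t (omap t x)) \<cdot> amap p (\<alpha> (omap t x)) \<cdot> amap p (amap t (\<alpha> x))"
  \<comment> \<open>\<open>?m\<close> is what the left side will produce under \<open>L\<close>: two
    uses of \<alpha>, then \<open>u\<close>, then two multiplications. Associativity replaces the
    inner \<mu> by \<open>t\<close> of \<mu>, which naturality carries back across \<open>u\<close>
    to where \<open>alpha_mu\<close> applies.\<close>
  have m: "?m = ?g x \<cdot> amap p (\<mu> (omap k x))"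
  proof -
    have "?m = amap L (amap p (\<mu> x \<cdot>\<^bsub>C\<^esub> \<mu> (omap t x)))
        \<cdot> u (omap t (omap t x)) \<cdot> amap p (\<alpha> (omap t x) \<cdot>\<^bsub>C\<^esub> amap t (\<alpha> x))"
      using x by (simp add: all_typing P.B.Comp_assoc_Arr P.amap_Comp_Arr L.amap_Comp_Arr)
    also have "\<mu> x \<cdot>\<^bsub>C\<^esub> \<mu> (omap t x) = \<mu> x \<cdot>\<^bsub>C\<^esub> amap t (\<mu> x)"
      using x by (simp add: T.mu_assoc)
    also have "amap L (amap p (\<mu> x \<cdot>\<^bsub>C\<^esub> amap t (\<mu> x)))
        \<cdot> u (omap t (omap t x)) \<cdot> amap p (\<alpha> (omap t x) \<cdot>\<^bsub>C\<^esub> amap t (\<alpha> x))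
      = amap L (amap p (\<mu> x)) \<cdot> (amap L (amap p (amap t (\<mu> x))) \<cdot> u (omap t (omap t x)))
        \<cdot> amap p (\<alpha> (omap t x) \<cdot>\<^bsub>C\<^esub> amap t (\<alpha> x))"
      using x by (simp add: all_typing P.B.Comp_assoc_Arr P.amap_Comp_Arr L.amap_Comp_Arr)
    also have "amap L (amap p (amap t (\<mu> x))) \<cdot> u (omap t (omap t x))
        = u (omap t x) \<cdot> amap p (amap k (\<mu> x))"
      using x u.naturality_Arr[of "\<mu> x"] by (simp add: all_typing)
    also have "amap L (amap p (\<mu> x)) \<cdot> (u (omap t x) \<cdot> amap p (amap k (\<mu> x)))
        \<cdot> amap p (\<alpha> (omap t x) \<cdot>\<^bsub>C\<^esub> amap t (\<alpha> x))
      = amap L (amap p (\<mu> x)) \<cdot> u (omap t x)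
        \<cdot> amap p (amap k (\<mu> x) \<cdot>\<^bsub>C\<^esub> \<alpha> (omap t x) \<cdot>\<^bsub>C\<^esub> amap t (\<alpha> x))"
      using x by (simp add: all_typing P.B.Comp_assoc_Arr P.amap_Comp_Arr)
    also have "amap k (\<mu> x) \<cdot>\<^bsub>C\<^esub> \<alpha> (omap t x) \<cdot>\<^bsub>C\<^esub> amap t (\<alpha> x) = \<alpha> x \<cdot>\<^bsub>C\<^esub> \<mu> (omap k x)"
      using x by (simp add: alpha_mu)
    also have "amap L (amap p (\<mu> x)) \<cdot> u (omap t x) \<cdot> amap p (\<alpha> x \<cdot>\<^bsub>C\<^esub> \<mu> (omap k x))
        = ?g x \<cdot> amap p (\<mu> (omap k x))"
      using x by (simp add: all_typing P.B.Comp_assoc_Arr P.amap_Comp_Arr)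
    finally show ?thesis .
  qed
  have "(amap L ?d \<cdot> ?d) \<cdot> u x = amap L ?d \<cdot> comult_datum x"
    using x by (simp add: all_typing P.B.Comp_assoc_Arr comult_u)
  also have "\<dots> = amap L (?d \<cdot> ?g x) \<cdot> ?h x"
    using x by (simp add: comult_datum_def all_typing P.B.Comp_assoc_Arr L.amap_Comp_Arr)
  also have "?d \<cdot> ?g x = (?d \<cdot> amap L (amap p (\<mu> x))) \<cdot> u (omap t x) \<cdot> amap p (\<alpha> x)"
    using x by (simp add: all_typing P.B.Comp_assoc_Arr)
  \<comment> \<open>Naturality of \<delta>' along \<open>p\<close> of \<mu> places \<delta>' next to
    \<open>u\<close> at \<open>t x\<close>, where it unfolds to \<open>comult_datum\<close>.\<close>
  also have "?d \<cdot> amap L (amap p (\<mu> x))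
      = amap L (amap L (amap p (\<mu> x))) \<cdot> \<delta>' (omap p (omap t (omap t x)))"
    using x d.naturality_Arr[of "amap p (\<mu> x)"] by (simp add: all_typing)
  also have "(amap L (amap L (amap p (\<mu> x))) \<cdot> \<delta>' (omap p (omap t (omap t x))))
        \<cdot> u (omap t x) \<cdot> amap p (\<alpha> x)
      = amap L (amap L (amap p (\<mu> x)))
        \<cdot> (\<delta>' (omap p (omap t (omap t x))) \<cdot> u (omap t x)) \<cdot> amap p (\<alpha> x)"
    using x by (simp add: all_typing P.B.Comp_assoc_Arr)
  also have "\<dots> = amap L (amap L (amap p (\<mu> x)) \<cdot> ?g (omap t x)) \<cdot> u (omap k (omap t x))
      \<cdot> amap p (\<delta> (omap t x) \<cdot>\<^bsub>C\<^esub> \<alpha> x)"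
    using x by (simp add: comult_u comult_datum_def all_typing P.B.Comp_assoc_Arr
        P.amap_Comp_Arr L.amap_Comp_Arr)
  also have "\<delta> (omap t x) \<cdot>\<^bsub>C\<^esub> \<alpha> x = amap k (\<alpha> x) \<cdot>\<^bsub>C\<^esub> \<alpha> (omap k x) \<cdot>\<^bsub>C\<^esub> amap t (\<delta> x)"
    using x by (simp add: delta_alpha)
  also have "amap L (amap L (amap p (\<mu> x)) \<cdot> ?g (omap t x)) \<cdot> u (omap k (omap t x))
        \<cdot> amap p (amap k (\<alpha> x) \<cdot>\<^bsub>C\<^esub> \<alpha> (omap k x) \<cdot>\<^bsub>C\<^esub> amap t (\<delta> x))
      = amap L (amap L (amap p (\<mu> x)) \<cdot> ?g (omap t x))
        \<cdot> (u (omap k (omap t x)) \<cdot> amap p (amap k (\<alpha> x)))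
        \<cdot> amap p (\<alpha> (omap k x) \<cdot>\<^bsub>C\<^esub> amap t (\<delta> x))"
    using x by (simp add: all_typing P.B.Comp_assoc_Arr P.amap_Comp_Arr)
  \<comment> \<open>The outermost \<alpha> from \<open>delta_alpha\<close> crosses \<open>u\<close>
    and becomes the last factor of \<open>?m\<close>.\<close>
  also have "u (omap k (omap t x)) \<cdot> amap p (amap k (\<alpha> x))
      = amap L (amap p (amap t (\<alpha> x))) \<cdot> u (omap t (omap k x))"
    using x u.naturality_Arr[of "\<alpha> x"] by (simp add: all_typing)
  also have "amap L (amap L (amap p (\<mu> x)) \<cdot> ?g (omap t x))
        \<cdot> (amap L (amap p (amap t (\<alpha> x))) \<cdot> u (omap t (omap k x)))
        \<cdot> amap p (\<alpha> (omap k x) \<cdot>\<^bsub>C\<^esub> amap t (\<delta> x))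
      = amap L ?m \<cdot> u (omap t (omap k x)) \<cdot> amap p (\<alpha> (omap k x)) \<cdot> amap p (amap t (\<delta> x))"
    using x by (simp add: all_typing P.B.Comp_assoc_Arr P.amap_Comp_Arr L.amap_Comp_Arr)
  also have "\<dots> = amap L (?g x) \<cdot> amap L (amap p (\<mu> (omap k x)))
      \<cdot> u (omap t (omap k x)) \<cdot> amap p (\<alpha> (omap k x)) \<cdot> amap p (amap t (\<delta> x))"
    unfolding m using x by (simp add: all_typing P.B.Comp_assoc_Arr L.amap_Comp_Arr)
  \<comment> \<open>The \<mu> at \<open>k x\<close> released by \<open>m\<close> completes a second
    copy of \<open>?g\<close>.\<close>
  also have "\<dots> = amap L (?g x) \<cdot> ?g (omap k x) \<cdot> amap p (amap t (\<delta> x))"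
    using x by (simp add: all_typing P.B.Comp_assoc_Arr)
  finally have left: "(amap L ?d \<cdot> ?d) \<cdot> u x
      = amap L (amap L (?g x) \<cdot> ?g (omap k x) \<cdot> amap p (amap t (\<delta> x))) \<cdot> ?h x" .
  \<comment> \<open>From the common form towards the right side: \<open>t\<close> of \<delta>
    crosses \<open>u\<close> and meets the other \<delta>, so that coassociativity applies.\<close>
  have "amap L (amap L (?g x) \<cdot> ?g (omap k x) \<cdot> amap p (amap t (\<delta> x))) \<cdot> ?h x
      = amap L (amap L (?g x) \<cdot> ?g (omap k x))
        \<cdot> (amap L (amap p (amap t (\<delta> x))) \<cdot> u (omap k x)) \<cdot> amap p (\<delta> x)"
    using x by (simp add: all_typing P.B.Comp_assoc_Arr L.amap_Comp_Arr)
  also have "amap L (amap p (amap t (\<delta> x))) \<cdot> u (omap k x)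
      = u (omap k (omap k x)) \<cdot> amap p (amap k (\<delta> x))"
    using x u.naturality_Arr[of "\<delta> x"] by (simp add: all_typing)
  also have "amap L (amap L (?g x) \<cdot> ?g (omap k x))
        \<cdot> (u (omap k (omap k x)) \<cdot> amap p (amap k (\<delta> x))) \<cdot> amap p (\<delta> x)
      = amap L (amap L (?g x) \<cdot> ?g (omap k x))
        \<cdot> u (omap k (omap k x)) \<cdot> amap p (amap k (\<delta> x) \<cdot>\<^bsub>C\<^esub> \<delta> x)"
    using x by (simp add: all_typing P.B.Comp_assoc_Arr P.amap_Comp_Arr)
  also have "amap k (\<delta> x) \<cdot>\<^bsub>C\<^esub> \<delta> x = \<delta> (omap k x) \<cdot>\<^bsub>C\<^esub> \<delta> x"
    using x by (simp add: K.delta_coassoc)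
  also have "amap L (amap L (?g x) \<cdot> ?g (omap k x))
        \<cdot> u (omap k (omap k x)) \<cdot> amap p (\<delta> (omap k x) \<cdot>\<^bsub>C\<^esub> \<delta> x)
      = amap L (amap L (?g x)) \<cdot> comult_datum (omap k x) \<cdot> amap p (\<delta> x)"
    using x by (simp add: comult_datum_def all_typing P.B.Comp_assoc_Arr P.amap_Comp_Arr
        L.amap_Comp_Arr)
  \<comment> \<open>Reading \<open>comult_u\<close> backwards at \<open>k x\<close> recreates
    \<delta>', which naturality then carries to the left of \<open>amap L (?g x)\<close>.\<close>
  also have "\<dots> = (amap L (amap L (?g x)) \<cdot> \<delta>' (omap p (omap t (omap k x)))) \<cdot> ?h x"
    using x by (simp add: all_typing P.B.Comp_assoc_Arr flip: comult_u)
  also have "amap L (amap L (?g x)) \<cdot> \<delta>' (omap p (omap t (omap k x)))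
      = \<delta>' (omap L (omap p (omap t x))) \<cdot> amap L (?g x)"
    using x d.naturality_Arr[of "?g x"] by (simp add: all_typing)
  also have "(\<delta>' (omap L (omap p (omap t x))) \<cdot> amap L (?g x)) \<cdot> ?h x
      = \<delta>' (omap L (omap p (omap t x))) \<cdot> comult_datum x"
    using x by (simp add: comult_datum_def all_typing P.B.Comp_assoc_Arr)
  also have "\<dots> = (\<delta>' (omap L (omap p (omap t x))) \<cdot> ?d) \<cdot> u x"
    using x by (simp add: all_typing P.B.Comp_assoc_Arr comult_u)
  finally show ?thesis
    using left by simp
qed

text \<open>Each law equates two transformations out of \<open>L\<close>, so by uniqueness it
  suffices to compare them along \<open>u\<close>.\<close>

lemma comonad_of_data: "comonad D L \<epsilon>' \<delta>'"
proof -
  note id = nat_trans_Ide[OF L.is_functor_axioms]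
  have Ld: "nat_trans D D L (L \<circ>F L \<circ>F L) (\<lambda>x. amap L (\<delta>' x) \<cdot> \<delta>' x)"
    by (rule nat_trans_vcomp[OF comult nat_trans_whisker_left[OF comult L.is_functor_axioms]])
  \<comment> \<open>Whiskering gives the target bracketed to the left; it must be the same functor
    as in \<open>Ld\<close> for uniqueness to apply.\<close>
  have dL: "nat_trans D D L (L \<circ>F L \<circ>F L) (\<lambda>x. \<delta>' (omap L x) \<cdot> \<delta>' x)"
    using nat_trans_vcomp[OF comult nat_trans_whisker_right[OF comult L.is_functor_axioms]]
    by (simp add: compF_assoc)
  have Le: "nat_trans D D L L (\<lambda>x. amap L (\<epsilon>' x) \<cdot> \<delta>' x)"
    using nat_trans_vcomp[OF comult nat_trans_whisker_left[OF counit L.is_functor_axioms]]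
    by simp
  have eL: "nat_trans D D L L (\<lambda>x. \<epsilon>' (omap L x) \<cdot> \<delta>' x)"
    using nat_trans_vcomp[OF comult nat_trans_whisker_right[OF counit L.is_functor_axioms]]
    by simp
  have idu: "Ide D (omap L (omap p (omap t x))) \<cdot> u x = u x" if "x \<in> Obj C" for x
    using that by (simp add: typing P.B.Comp_Ide_left_Arr)
  show ?thesis
  proof unfold_locales
    fix y assume y: "y \<in> Obj D"
    show "amap L (\<delta>' y) \<cdot> \<delta>' y = \<delta>' (omap L y) \<cdot> \<delta>' y"
      by (rule left_kan_extension_unique[OF lan Ld dL _ y]) (simp add: coassoc_u)
    show "\<epsilon>' (omap L y) \<cdot> \<delta>' y = Ide D (omap L y)"
      by (rule left_kan_extension_unique[OF lan eL id _ y]) (simp add: counit_left_u idu)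
    show "amap L (\<epsilon>' y) \<cdot> \<delta>' y = Ide D (omap L y)"
      by (rule left_kan_extension_unique[OF lan Le id _ y]) (simp add: counit_right_u idu)
  qed
qed

end

section \<open>Existence of the comonad structure\<close>

theorem comonad_left_kan_extension: "\<exists>\<epsilon>' \<delta>'. comonad D L \<epsilon>' \<delta>'"
proof -
  \<comment> \<open>The universal property is used with \<open>s = idF\<close> for the counit and
    with \<open>s = L \<circ>F L\<close> for the comultiplication.\<close>
  obtain \<epsilon>' where "nat_trans D D L idF \<epsilon>'"
    "\<And>x. x \<in> Obj C \<Longrightarrow> \<epsilon>' (omap (p \<circ>F t) x) \<cdot> u x = counit_datum x"
    using left_kan_extension_factor[OF lan nat_trans_counit_datum
        is_functor_idF[OF P.B.category_axioms]] by blast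
  moreover obtain \<delta>' where "nat_trans D D L (L \<circ>F L) \<delta>'"
    "\<And>x. x \<in> Obj C \<Longrightarrow> \<delta>' (omap (p \<circ>F t) x) \<cdot> u x = comult_datum x"
    using left_kan_extension_factor[OF lan nat_trans_comult_datum
        is_functor_compF[OF L.is_functor_axioms L.is_functor_axioms]] by blast
  ultimately have "comonad D L \<epsilon>' \<delta>'"
    by (intro comonad_of_data) simp_all
  then show ?thesis
    by blast
qed

end

theorem theorem4p7:
  fixes \<kappa> :: "'u rel"
    and C :: "('c, 'f) cat"
    and D :: "('d, 'g) cat"
    and t k :: "('c, 'f, 'c, 'f) ftor"
    and p :: "('c, 'f, 'd, 'g) ftor"
    and L :: "('d, 'g, 'd, 'g) ftor"
    and \<eta> \<mu> \<epsilon> \<delta> \<alpha> :: "'c \<Rightarrow> 'f"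
    and u :: "'c \<Rightarrow> 'g"
  assumes "inaccessible \<kappa>"
    and "accessible_category \<kappa> C"
    and "accessible_category \<kappa> D"
    and "cocomplete \<kappa> D"
    and "accessible_monad \<kappa> C t \<eta> \<mu>"
    and "accessible_comonad \<kappa> C k \<epsilon> \<delta>"
    and "distributive_law C t \<eta> \<mu> k \<epsilon> \<delta> \<alpha>"
    and "accessible_functor \<kappa> C D p"
    and "left_kan_extension C D D (p \<circ>F t) (p \<circ>F k) L u"
  shows "\<exists>\<epsilon>' \<delta>'. comonad D L \<epsilon>' \<delta>'"
proof -
  interpret distributive_law_kan C t \<eta> \<mu> k \<epsilon> \<delta> \<alpha> D p L u
    using assms by (simp add: distributive_law_kan_def distributive_law_kan_axioms_def
        accessible_functor_def)
  show ?thesis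
    by (rule comonad_left_kan_extension)
qed

end
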